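(* Let $f:\mathbb{R}^d\to\mathbb{R}$ be differentiable. For constants $L_0,L_1>0$ and $\alpha\in(0,1)$ put $$K_0:=L_0\big(2^{\frac{\alpha^2}{1-\alpha}}+1\big),\quad K_1:=L_1\cdot 2^{\frac{\alpha^2}{1-\alpha}}\cdot 3^{\alpha},\quad K_2:=L_1^{\frac{1}{1-\alpha}}\cdot 2^{\frac{\alpha^2}{1-\alpha}}\cdot 3^{\alpha}(1-\alpha)^{\frac{\alpha}{1-\alpha}}.$$ 1. For any $\alpha\in(0,1)$: $f\in\mathcal{L}_{\mathrm{sym}}^*(\alpha)$ if and only if there are constants $L_0,L_1>0$ such that for all $w,w'\in\mathbb{R}^d$, $$\|\nabla f(w')-\nabla f(w)\|\le\|w'-w\|\big(K_0+K_1\|\nabla f(w)\|^{\alpha}+K_2\|w'-w\|^{\frac{\alpha}{1-\alpha}}\big);$$ in the forward implication $L_0,L_1$ are the constants with which $f$ satisfies the definition of $\mathcal{L}_{\mathrm{sym}}^*(\alpha)$. 2. For $\alpha=1$: $f\in\mathcal{L}_{\mathrm{sym}}^*(1)$ if and only if there are constants $L_0,L_1>0$ such that for all $w,w'\in\mathbb{R}^d$, $$\|\nabla f(w')-\nabla f(w)\|\le\|w'-w\|\big(L_0+L_1\|\nabla f(w)\|\big)\exp\big(L_1\|w'-w\|\big);$$ in the forward implication $L_0,L_1$ are the constants with which $f$ satisfies the definition of $\mathcal{L}_{\mathrm{sym}}^*(1)$. Consequently, the following descent inequalities hold, where $L_0,L_1$ are the constants with which $f$ satisfies the definition of $\mathcal{L}_{\mathrm{sym}}^*(\alpha)$.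 3. If $f\in\mathcal{L}_{\mathrm{sym}}^*(\alpha)$ with $\alpha\in(0,1)$, then for all $w,w'\in\mathbb{R}^d$, $$f(w')\le f(w)+\nabla f(w)^{\top}(w'-w)+\tfrac12\|w'-w\|^2\big(K_0+K_1\|\nabla f(w)\|^{\alpha}+2K_2\|w'-w\|^{\frac{\alpha}{1-\alpha}}\big).$$ 4. If $f\in\mathcal{L}_{\mathrm{sym}}^*(1)$, then for all $w,w'\in\mathbb{R}^d$, $$f(w')\le f(w)+\nabla f(w)^{\top}(w'-w)+\tfrac12\|w'-w\|^2\big(L_0+L_1\|\nabla f(w)\|\big)\exp\big(L_1\|w'-w\|\big).$$
   Context: For $\alpha\in[0,1]$, $\mathcal{L}_{\mathrm{sym}}^*(\alpha)$ is the class of differentiable $f:\mathbb{R}^d\to\mathbb{R}$ for which there are constants $L_0,L_1>0$ with $$\|\nabla f(w')-\nabla f(w)\|\le\Big(L_0+L_1\max_{\theta\in[0,1]}\|\nabla f(\theta w'+(1-\theta)w)\|^{\alpha}\Big)\|w'-w\|\quad\text{for all } w,w'\in\mathbb{R}^d.$$ Norms are Euclidean. Convention: $0^0=1$. *)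

theory Defs
  imports "HOL-Analysis.Analysis"
begin

definition grad :: "('a::real_inner \<Rightarrow> real) \<Rightarrow> 'a \<Rightarrow> 'a" where
  "grad f x = (THE D. GDERIV f x :> D)"

lemma GDERIV_unique:
  assumes "GDERIV f x :> D" "GDERIV f x :> E"
  shows "D = E"
proof -
  have "(\<lambda>h. h \<bullet> D) = (\<lambda>h. h \<bullet> E)"
    using assms unfolding gderiv_def by (rule has_derivative_unique)
  then have "\<forall>h. h \<bullet> D = h \<bullet> E"
    by (simp add: fun_eq_iff)
  then show ?thesis
    by (rule iffD1[OF vector_eq_ldot])
qed

lemma grad_eqI: "GDERIV f x :> D \<Longrightarrow> grad f x = D"
  unfolding grad_def by (rule the_equality) (auto intro: GDERIV_unique)

lemma GDERIV_grad:
  fixes f :: "'a::euclidean_space \<Rightarrow> real"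
  assumes "f differentiable (at x)"
  shows "GDERIV f x :> grad f x"
proof -
  obtain f' where f': "(f has_derivative f') (at x)"
    using assms unfolding differentiable_def by blast
  then have lin: "linear f'"
    by (rule has_derivative_linear)
  define D where "D = adjoint f' 1"
  have "f' = (\<lambda>h. h \<bullet> D)"
    by (rule ext) (simp add: D_def adjoint_works[OF lin])
  then have "GDERIV f x :> D"
    using f' unfolding gderiv_def by (simp only:)
  then show ?thesis
    using grad_eqI[of f x D] by simp
qed

text \<open>The power of a nonnegative base with the convention that zero to the power zero is one;
  the library has \<open>0 powr 0 = 0\<close>.\<close>

definition nnpow :: "real \<Rightarrow> real \<Rightarrow> real" where
  "nnpow x a = (if a = 0 then 1 else x powr a)"

text \<open>The maximum over the segment is part of the condition: \<open>M\<close> is required to be attained,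
  because a supremum over the reals would take an arbitrary value if the gradient were
  unbounded on the segment.\<close>

definition sym_smooth_with ::
    "real \<Rightarrow> real \<Rightarrow> real \<Rightarrow> ('a::real_inner \<Rightarrow> real) \<Rightarrow> bool" where
  "sym_smooth_with \<alpha> L0 L1 f \<longleftrightarrow> L0 > 0 \<and> L1 > 0 \<and>
     (\<forall>w w'. \<exists>M \<in> (\<lambda>\<theta>. nnpow (norm (grad f (\<theta> *\<^sub>R w' + (1 - \<theta>) *\<^sub>R w))) \<alpha>) ` {0..1}.
        (\<forall>\<theta> \<in> {0..1}. nnpow (norm (grad f (\<theta> *\<^sub>R w' + (1 - \<theta>) *\<^sub>R w))) \<alpha> \<le> M) \<and>
        norm (grad f w' - grad f w) \<le> (L0 + L1 * M) * norm (w' - w))"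

definition Lsym :: "real \<Rightarrow> ('a::real_inner \<Rightarrow> real) set" where
  "Lsym \<alpha> = {f. (\<forall>x. f differentiable (at x)) \<and> (\<exists>L0 L1. sym_smooth_with \<alpha> L0 L1 f)}"

definition K0 :: "real \<Rightarrow> real \<Rightarrow> real" where
  "K0 \<alpha> L0 = L0 * (2 powr (\<alpha>\<^sup>2 / (1 - \<alpha>)) + 1)"

definition K1 :: "real \<Rightarrow> real \<Rightarrow> real" where
  "K1 \<alpha> L1 = L1 * 2 powr (\<alpha>\<^sup>2 / (1 - \<alpha>)) * 3 powr \<alpha>"

definition K2 :: "real \<Rightarrow> real \<Rightarrow> real" where
  "K2 \<alpha> L1 = L1 powr (1 / (1 - \<alpha>)) * 2 powr (\<alpha>\<^sup>2 / (1 - \<alpha>)) * 3 powr \<alpha>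
     * (1 - \<alpha>) powr (\<alpha> / (1 - \<alpha>))"

definition growth_bound ::
    "real \<Rightarrow> real \<Rightarrow> real \<Rightarrow> ('a::real_inner \<Rightarrow> real) \<Rightarrow> bool" where
  "growth_bound \<alpha> L0 L1 f \<longleftrightarrow>
     (\<forall>w w'. norm (grad f w' - grad f w) \<le> norm (w' - w) *
        (K0 \<alpha> L0 + K1 \<alpha> L1 * norm (grad f w) powr \<alpha>
          + K2 \<alpha> L1 * norm (w' - w) powr (\<alpha> / (1 - \<alpha>))))"

definition exp_growth_bound ::
    "real \<Rightarrow> real \<Rightarrow> ('a::real_inner \<Rightarrow> real) \<Rightarrow> bool" where
  "exp_growth_bound L0 L1 f \<longleftrightarrow>
     (\<forall>w w'. norm (grad f w' - grad f w) \<le>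
        norm (w' - w) * (L0 + L1 * norm (grad f w)) * exp (L1 * norm (w' - w)))"

end

theory Submission
  imports Defs
begin

text \<open>
  Write \<open>g\<close> for the norm of the gradient. Applied to short pieces of the segment from \<open>w\<close> to
  \<open>w'\<close>, the symmetric condition says that \<open>g\<close> grows along the segment at rate at most
  \<open>(L0 + L1 * g powr \<alpha>) * norm (w' - w)\<close>. The gradient need not be differentiable, so the
  comparison with the solution of the corresponding differential equation is done with increments
  instead of derivatives: if \<open>F\<close> is an antiderivative of \<open>1 / h\<close> and \<open>g\<close> grows at rate at most
  \<open>C * h g\<close>, then \<open>F g\<close> grows by at most \<open>C\<close> on the unit interval (\<open>bihari_inequality\<close>).

  For \<open>\<alpha> = 1\<close> the rate is linear, \<open>F\<close> is a logarithm, and \<open>L0 + L1 * g\<close> gains at most the factor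
  \<open>exp (L1 * norm (w' - w))\<close>. For \<open>\<alpha> < 1\<close> put \<open>a = (L0 / L1) powr (1 / \<alpha>)\<close>. By concavity the rate
  \<open>L1 * (a powr \<alpha> + g powr \<alpha>)\<close> is at most \<open>2 powr (1 - \<alpha>) * L1 * (a + g) powr \<alpha>\<close>, so
  \<open>(a + g) powr (1 - \<alpha>)\<close> grows at most linearly. Raising to the power \<open>1 / (1 - \<alpha>)\<close> by convexity
  costs the factor \<open>2 powr (\<alpha> / (1 - \<alpha>))\<close>, whose \<open>\<alpha>\<close>-th power is the factor
  \<open>2 powr (\<alpha>\<^sup>2 / (1 - \<alpha>))\<close> of the constants. In both cases the resulting bound for \<open>g\<close> on the
  whole segment, inserted in the symmetric condition, is the growth bound.

  Conversely, both growth bounds have the form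
  \<open>norm (w' - w) * (A + B * g powr \<alpha>) * \<rho> (norm (w' - w))\<close> with \<open>g\<close> taken at \<open>w\<close> only and
  \<open>\<rho>\<close> tending to 1 at 0. Hence the gradient is continuous, so the maximum over a segment is
  attained, and cutting the segment into ever shorter pieces removes \<open>\<rho>\<close>
  (\<open>sym_smooth_with_if_local_bound\<close>).

  The descent inequalities follow from the growth bounds by comparing the derivative of \<open>f\<close> along
  the segment with that of a quadratic (\<open>descent_inequality\<close>).
\<close>

section \<open>Comparison on the unit interval\<close>

text \<open>A mean value inequality without derivatives: the one-sided slope is bounded by
  \<open>C + e\<close> at a scale \<open>d\<close> that is uniform over the interval, so the increments over a fine
  equidistant partition add up.\<close>

lemma increment_le_of_local_slope:
  fixes z :: "real \<Rightarrow> real"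
  assumes slope: "\<And>e. e > 0 \<Longrightarrow> \<exists>d>0. \<forall>t s. 0 \<le> t \<and> t \<le> s \<and> s \<le> 1 \<and> s < t + d
                    \<longrightarrow> z s - z t \<le> (C + e) * (s - t)"
  shows "z 1 \<le> z 0 + C"
proof (rule field_le_epsilon)
  fix e :: real assume "e > 0"
  then obtain d where d: "d > 0" and
    step: "\<And>t s. 0 \<le> t \<Longrightarrow> t \<le> s \<Longrightarrow> s \<le> 1 \<Longrightarrow> s < t + d \<Longrightarrow> z s - z t \<le> (C + e) * (s - t)"
    using slope by metis
  obtain n :: nat where n: "n > 0" "inverse (real n) < d"
    using d ex_inverse_of_nat_less by blast
  have "z (real k / n) \<le> z 0 + (C + e) * (real k / n)" if "k \<le> n" for k
    using that
  proof (induction k)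
    case (Suc k)
    have "z (real (Suc k) / n) - z (real k / n) \<le> (C + e) * (real (Suc k) / n - real k / n)"
      using Suc.prems n by (intro step) (auto simp: divide_simps)
    with Suc show ?case by (simp add: right_diff_distrib)
  qed simp
  from this[of n] show "z 1 \<le> z 0 + C + e" using n by simp
qed

text \<open>The Bihari form of Gronwall's inequality. By the mean value theorem an increment of \<open>F\<close>
  is an increment of \<open>g\<close> divided by a value of \<open>h\<close>, and that value is attained along \<open>g\<close> on the
  same short interval as the value of \<open>h\<close> in the hypothesis. Uniform continuity makes their
  quotient as close to 1 as desired.\<close>

lemma bihari_inequality:
  fixes g h F :: "real \<Rightarrow> real"
  assumes g: "continuous_on {0..1} g"
    and h: "continuous_on (g ` {0..1}) h" "\<And>x. x \<in> g ` {0..1} \<Longrightarrow> h x > 0"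
    and F: "\<And>x. x \<in> g ` {0..1} \<Longrightarrow> DERIV F x :> 1 / h x"
    and C: "C \<ge> 0"
    and step: "\<And>t s. 0 \<le> t \<Longrightarrow> t \<le> s \<Longrightarrow> s \<le> 1 \<Longrightarrow>
                 \<exists>\<tau>\<in>{t..s}. g s - g t \<le> C * h (g \<tau>) * (s - t)"
  shows "F (g 1) \<le> F (g 0) + C"
proof -
  define H where "H = (\<lambda>t. h (g t))"
  have contH: "continuous_on {0..1} H"
    unfolding H_def using h(1) g by (rule continuous_on_compose2) auto
  then obtain u where u: "u \<in> {0..1}" "\<And>t. t \<in> {0..1} \<Longrightarrow> H u \<le> H t"
    using continuous_attains_inf[OF _ _ contH] by auto
  have Hpos: "H t > 0" if "t \<in> {0..1}" for t
    using h(2) that by (auto simp: H_def)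
  have unif: "uniformly_continuous_on {0..1} H"
    using contH by (intro compact_uniformly_continuous) auto
  have ivt: "\<exists>\<tau>\<in>{t..s}. g \<tau> = x"
    if "0 \<le> t" "t \<le> s" "s \<le> 1" "g t \<le> x \<and> x \<le> g s \<or> g s \<le> x \<and> x \<le> g t" for t s x
  proof -
    have "continuous_on {t..s} g"
      using g that by (auto elim: continuous_on_subset)
    then show ?thesis
      using that IVT'[of g t x s] IVT2'[of g s x t] by (auto simp: Bex_def)
  qed
  show ?thesis
  proof (rule increment_le_of_local_slope[where z = "\<lambda>t. F (g t)"])
    fix e :: real assume "e > 0"
    \<comment> \<open>Relative oscillation allowed for \<open>H\<close>; the \<open>+ 1\<close> covers \<open>C = 0\<close>.\<close>
    define r where "r = e / (C + 1)"
    have r: "r > 0" "C * r \<le> e"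
      using \<open>e > 0\<close> C by (auto simp: r_def field_simps)
    have "r * H u > 0" using r Hpos[OF u(1)] by simp
    then obtain d where d: "d > 0" and
      close: "\<And>x y. x \<in> {0..1} \<Longrightarrow> y \<in> {0..1} \<Longrightarrow> dist x y < d \<Longrightarrow> dist (H x) (H y) < r * H u"
      using unif unfolding uniformly_continuous_on_def by metis
    have "F (g s) - F (g t) \<le> (C + e) * (s - t)"
      if ts: "0 \<le> t" "t \<le> s" "s \<le> 1" "s < t + d" for t s
    proof (cases "g t < g s")
      case True
      have "\<exists>x. g t < x \<and> x < g s \<and> F (g s) - F (g t) = (g s - g t) * (1 / h x)"
      proof (rule MVT2[OF True])
        fix x assume "g t \<le> x" "x \<le> g s"
        then obtain \<tau> where "\<tau> \<in> {t..s}" "g \<tau> = x" using ivt ts by blast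
        then show "DERIV F x :> 1 / h x" using ts by (intro F) auto
      qed
      then obtain x where x: "g t < x" "x < g s" "F (g s) - F (g t) = (g s - g t) / h x"
        by auto
      then obtain \<xi> where \<xi>: "\<xi> \<in> {t..s}" "g \<xi> = x"
        using ivt[OF ts(1-3), of x] by auto
      obtain \<tau> where \<tau>: "\<tau> \<in> {t..s}" "g s - g t \<le> C * H \<tau> * (s - t)"
        using step[OF ts(1-3)] by (auto simp: H_def)
      have mem: "\<tau> \<in> {0..1}" "\<xi> \<in> {0..1}" using \<tau> \<xi> ts by auto
      have "dist \<tau> \<xi> < d" using \<tau> \<xi> ts by (auto simp: dist_real_def)
      then have "H \<tau> \<le> H \<xi> + r * H u"
        using close[OF mem] by (auto simp: dist_real_def)
      also have "\<dots> \<le> (1 + r) * H \<xi>"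
        using u(2)[OF mem(2)] r by (simp add: distrib_right)
      finally have ratio: "H \<tau> \<le> (1 + r) * H \<xi>" .
      have "F (g s) - F (g t) \<le> C * H \<tau> * (s - t) / H \<xi>"
        using x \<tau> \<xi> Hpos[OF mem(2)] by (simp add: H_def divide_right_mono)
      also have "\<dots> \<le> C * ((1 + r) * H \<xi>) * (s - t) / H \<xi>"
        using ratio C ts Hpos[OF mem(2)]
        by (intro divide_right_mono mult_right_mono mult_left_mono) auto
      also have "\<dots> = (C + C * r) * (s - t)"
        using Hpos[OF mem(2)] by (simp add: field_simps)
      also have "\<dots> \<le> (C + e) * (s - t)"
        using r ts by (intro mult_right_mono) auto
      finally show ?thesis .
    next
      case False
      have "F (g s) \<le> F (g t)"
      proof (rule DERIV_nonneg_imp_nondecreasing[of "g s" "g t" F])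
        fix x assume "g s \<le> x" "x \<le> g t"
        then obtain \<tau> where "\<tau> \<in> {t..s}" "g \<tau> = x" using ivt ts by blast
        then have x: "x \<in> g ` {0..1}" using ts by auto
        have "1 / h x \<ge> 0" using h(2)[OF x] by simp
        with F[OF x] show "\<exists>y. DERIV F x :> y \<and> y \<ge> 0" by blast
      qed (use False in simp)
      moreover have "0 \<le> (C + e) * (s - t)" using C \<open>e > 0\<close> ts by simp
      ultimately show ?thesis by linarith
    qed
    with d show "\<exists>d>0. \<forall>t s. 0 \<le> t \<and> t \<le> s \<and> s \<le> 1 \<and> s < t + d
                    \<longrightarrow> F (g s) - F (g t) \<le> (C + e) * (s - t)" by blast
  qed
qed

section \<open>Power inequalities\<close>

lemma powr_add_le_convex:
  fixes x y p :: real
  assumes "x \<ge> 0" "y \<ge> 0" "p \<ge> 1"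
  shows "(x + y) powr p \<le> 2 powr (p - 1) * (x powr p + y powr p)"
proof (cases "x = 0 \<or> y = 0")
  case True
  have "1 \<le> 2 powr (p - 1)" using assms by (simp add: ge_one_powr_ge_zero)
  then have "1 * (x powr p + y powr p) \<le> 2 powr (p - 1) * (x powr p + y powr p)"
    by (intro mult_right_mono) auto
  with True show ?thesis by auto
next
  case False
  then have "((1 - 1/2) *\<^sub>R x + (1/2) *\<^sub>R y) powr p \<le> (1 - 1/2) * x powr p + (1/2) * y powr p"
    using assms by (intro convex_onD[OF powr_convex]) auto
  moreover have "(1 - 1/2) *\<^sub>R x + (1/2) *\<^sub>R y = (x + y) / 2" by simp
  ultimately have "((x + y) / 2) powr p \<le> (x powr p + y powr p) / 2"
    by (simp only:) simp
  then have "(x + y) powr p / 2 powr p \<le> (x powr p + y powr p) / 2"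
    using assms by (simp add: powr_divide)
  then show ?thesis by (simp add: powr_diff field_simps)
qed

text \<open>The convex inequality with exponent \<open>1 / a\<close>, applied to \<open>x powr a\<close> and \<open>y powr a\<close>.\<close>

lemma powr_add_le_concave:
  fixes x y a :: real
  assumes "x \<ge> 0" "y \<ge> 0" "0 < a" "a \<le> 1"
  shows "x powr a + y powr a \<le> 2 powr (1 - a) * (x + y) powr a"
proof -
  have "(x powr a + y powr a) powr (1 / a)
          \<le> 2 powr (1 / a - 1) * ((x powr a) powr (1 / a) + (y powr a) powr (1 / a))"
    using assms by (intro powr_add_le_convex) auto
  also have "\<dots> = 2 powr (1 / a - 1) * (x + y)"
    using assms by (simp add: powr_powr)
  finally have "((x powr a + y powr a) powr (1 / a)) powr a \<le> (2 powr (1 / a - 1) * (x + y)) powr a"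
    using assms by (intro powr_mono2) auto
  then show ?thesis
    using assms by (simp add: powr_powr powr_mult left_diff_distrib)
qed

text \<open>A summand \<open>z\<close> makes up the fraction \<open>z / (x + y)\<close> of the sum. Since this fraction is at
  most 1, it does not exceed its own power with exponent \<open>a\<close>.\<close>

lemma powr_add_le_powr:
  fixes x y a :: real
  assumes "x \<ge> 0" "y \<ge> 0" "0 < a" "a \<le> 1"
  shows "(x + y) powr a \<le> x powr a + y powr a"
proof (cases "x + y = 0")
  case False
  then have pos: "x + y > 0" using assms by auto
  have part: "z * (x + y) powr a \<le> (x + y) * z powr a" if "0 \<le> z" "z \<le> x + y" for z
  proof -
    have "(z / (x + y)) powr 1 \<le> (z / (x + y)) powr a"
      using assms that pos by (intro powr_mono') auto
    then show ?thesis using that pos by (simp add: powr_divide field_simps)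
  qed
  have "(x + y) * (x + y) powr a \<le> (x + y) * (x powr a + y powr a)"
    using part[of x] part[of y] assms by (simp add: algebra_simps)
  with pos show ?thesis by simp
qed (use assms in auto)

section \<open>From symmetric smoothness to growth bounds\<close>

lemma nnpow_eq_powr: "a \<noteq> 0 \<Longrightarrow> nnpow x a = x powr a"
  by (simp add: nnpow_def)

text \<open>The condition on a segment passes to all its subsegments; this locality is what turns it
  into a bound on the rate of change of the gradient.\<close>

lemma sym_smooth_on_line:
  fixes f :: "'a::real_inner \<Rightarrow> real" and w v :: 'a
  defines "p \<equiv> \<lambda>t. w + t *\<^sub>R v"
  assumes sym: "sym_smooth_with \<alpha> L0 L1 f" and "t \<le> s"
  shows "\<exists>\<tau>\<in>{t..s}.
           (\<forall>\<sigma>\<in>{t..s}. nnpow (norm (grad f (p \<sigma>))) \<alpha> \<le> nnpow (norm (grad f (p \<tau>))) \<alpha>) \<and>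
           norm (grad f (p s) - grad f (p t))
             \<le> (L0 + L1 * nnpow (norm (grad f (p \<tau>))) \<alpha>) * (norm v * (s - t))"
proof -
  have conv: "\<theta> *\<^sub>R p s + (1 - \<theta>) *\<^sub>R p t = p (t + \<theta> * (s - t))" for \<theta>
    by (simp add: p_def algebra_simps)
  have dist: "norm (p s - p t) = norm v * (s - t)"
    using \<open>t \<le> s\<close> by (simp add: p_def flip: scaleR_diff_left)
  let ?N = "\<lambda>\<sigma>. nnpow (norm (grad f (p \<sigma>))) \<alpha>"
  have "\<exists>M\<in>(\<lambda>\<theta>. nnpow (norm (grad f (\<theta> *\<^sub>R p s + (1 - \<theta>) *\<^sub>R p t))) \<alpha>) ` {0..1}.
      (\<forall>\<theta>\<in>{0..1}. nnpow (norm (grad f (\<theta> *\<^sub>R p s + (1 - \<theta>) *\<^sub>R p t))) \<alpha> \<le> M) \<and>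
      norm (grad f (p s) - grad f (p t)) \<le> (L0 + L1 * M) * norm (p s - p t)"
    using sym unfolding sym_smooth_with_def by (elim conjE allE)
  then obtain \<theta> where \<theta>: "\<theta> \<in> {0..1}"
    "\<And>\<eta>. \<eta> \<in> {0..1} \<Longrightarrow> ?N (t + \<eta> * (s - t)) \<le> ?N (t + \<theta> * (s - t))"
    "norm (grad f (p s) - grad f (p t)) \<le> (L0 + L1 * ?N (t + \<theta> * (s - t))) * norm (p s - p t)"
    unfolding conv by blast
  have "?N \<sigma> \<le> ?N (t + \<theta> * (s - t))" if \<sigma>: "\<sigma> \<in> {t..s}" for \<sigma>
  proof (cases "t = s")
    case False
    then show ?thesis
      using \<theta>(2)[of "(\<sigma> - t) / (s - t)"] \<sigma> by auto
  qed (use \<sigma> in auto)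
  moreover have "t + \<theta> * (s - t) \<in> {t..s}"
    using \<theta>(1) \<open>t \<le> s\<close> mult_right_mono[of \<theta> 1 "s - t"] by auto
  ultimately show ?thesis using \<theta>(3) unfolding dist by blast
qed

text \<open>The maximum over the whole segment serves as a Lipschitz constant on it.\<close>

lemma sym_smooth_continuous_on_segment:
  fixes f :: "'a::real_inner \<Rightarrow> real"
  assumes sym: "sym_smooth_with \<alpha> L0 L1 f"
  shows "continuous_on {0..1} (\<lambda>t. grad f (w + t *\<^sub>R v))"
proof -
  let ?N = "\<lambda>\<sigma>. nnpow (norm (grad f (w + \<sigma> *\<^sub>R v))) \<alpha>"
  have L: "L0 > 0" "L1 > 0" using sym by (auto simp: sym_smooth_with_def)
  obtain m where m: "\<And>\<sigma>. \<sigma> \<in> {0..1} \<Longrightarrow> ?N \<sigma> \<le> ?N m"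
    using sym_smooth_on_line[OF sym zero_le_one, of w v] by blast
  define K where "K = (L0 + L1 * ?N m) * norm v"
  have "?N m \<ge> 0" by (auto simp: nnpow_def)
  then have "K \<ge> 0" using L by (simp add: K_def)
  have mono: "norm (grad f (w + s *\<^sub>R v) - grad f (w + t *\<^sub>R v)) \<le> K * (s - t)"
    if "0 \<le> t" "t \<le> s" "s \<le> 1" for t s
  proof -
    obtain \<tau> where \<tau>: "\<tau> \<in> {t..s}" "norm (grad f (w + s *\<^sub>R v) - grad f (w + t *\<^sub>R v))
                        \<le> (L0 + L1 * ?N \<tau>) * (norm v * (s - t))"
      using sym_smooth_on_line[OF sym \<open>t \<le> s\<close>, of w v] by blast
    note \<tau>(2)
    also have "\<dots> \<le> (L0 + L1 * ?N m) * (norm v * (s - t))"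
      using m[of \<tau>] \<tau>(1) that L by (intro mult_right_mono add_left_mono mult_left_mono) auto
    finally show ?thesis by (simp add: K_def mult.assoc)
  qed
  have "K-lipschitz_on {0..1} (\<lambda>t. grad f (w + t *\<^sub>R v))"
  proof (rule lipschitz_onI)
    fix x y :: real assume "x \<in> {0..1}" "y \<in> {0..1}"
    then show "dist (grad f (w + x *\<^sub>R v)) (grad f (w + y *\<^sub>R v)) \<le> K * dist x y"
      using mono[of x y] mono[of y x]
      by (cases "x \<le> y") (auto simp: dist_norm norm_minus_commute)
  qed (use \<open>K \<ge> 0\<close> in simp)
  then show ?thesis by (rule lipschitz_on_continuous_on)
qed

text \<open>Replacing \<open>L0 + L1 * nnpow x \<alpha>\<close> by a majorant \<open>c * h x\<close> allows a choice of \<open>h\<close> for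
  which an antiderivative \<open>F\<close> of the reciprocal is explicit.\<close>

lemma sym_smooth_norm_grad_growth:
  fixes f :: "'a::real_inner \<Rightarrow> real" and h F :: "real \<Rightarrow> real"
  assumes sym: "sym_smooth_with \<alpha> L0 L1 f"
    and h: "continuous_on {0..} h" "\<And>x. x \<ge> 0 \<Longrightarrow> h x > 0"
    and F: "\<And>x. x \<ge> 0 \<Longrightarrow> DERIV F x :> 1 / h x"
    and c: "c \<ge> 0" "\<And>x. x \<ge> 0 \<Longrightarrow> L0 + L1 * nnpow x \<alpha> \<le> c * h x"
  shows "F (norm (grad f w')) \<le> F (norm (grad f w)) + c * norm (w' - w)"
proof -
  define p where "p = (\<lambda>t. w + t *\<^sub>R (w' - w))"
  define g where "g = (\<lambda>t. norm (grad f (p t)))"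
  have "F (g 1) \<le> F (g 0) + c * norm (w' - w)"
  proof (rule bihari_inequality[where F = F and g = g and h = h])
    show "continuous_on {0..1} g"
      unfolding g_def p_def by (intro continuous_on_norm sym_smooth_continuous_on_segment[OF sym])
    show "continuous_on (g ` {0..1}) h"
      using h(1) by (rule continuous_on_subset) (auto simp: g_def)
    fix t s :: real assume ts: "t \<le> s"
    obtain \<tau> where \<tau>: "\<tau> \<in> {t..s}" "norm (grad f (p s) - grad f (p t))
                        \<le> (L0 + L1 * nnpow (g \<tau>) \<alpha>) * (norm (w' - w) * (s - t))"
      using sym_smooth_on_line[OF sym ts, of w "w' - w"] unfolding g_def p_def by blast
    have "g s - g t \<le> norm (grad f (p s) - grad f (p t))"
      unfolding g_def by (rule norm_triangle_ineq2)
    also note \<tau>(2)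
    also have "(L0 + L1 * nnpow (g \<tau>) \<alpha>) * (norm (w' - w) * (s - t))
                 \<le> c * h (g \<tau>) * (norm (w' - w) * (s - t))"
      using ts c(2)[of "g \<tau>"] by (intro mult_right_mono) (auto simp: g_def)
    finally show "\<exists>\<tau>\<in>{t..s}. g s - g t \<le> c * norm (w' - w) * h (g \<tau>) * (s - t)"
      using \<tau>(1) by (auto simp: mult_ac)
  qed (auto simp: g_def h F c)
  then show ?thesis by (simp add: g_def p_def)
qed

text \<open>A bound on the gradient in a ball around \<open>w\<close> suffices, because the growth estimates
  depend on the distance to \<open>w\<close> only and the ball contains the segment.\<close>

lemma sym_smooth_increment_le:
  fixes f :: "'a::real_inner \<Rightarrow> real"
  assumes sym: "sym_smooth_with \<alpha> L0 L1 f"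
    and B: "\<And>u. norm (u - w) \<le> norm (w' - w) \<Longrightarrow> nnpow (norm (grad f u)) \<alpha> \<le> B"
  shows "norm (grad f w' - grad f w) \<le> (L0 + L1 * B) * norm (w' - w)"
proof -
  let ?N = "\<lambda>\<sigma>. nnpow (norm (grad f (w + \<sigma> *\<^sub>R (w' - w)))) \<alpha>"
  have L: "L1 > 0" using sym by (auto simp: sym_smooth_with_def)
  obtain \<tau> where \<tau>: "\<tau> \<in> {0..1}" "norm (grad f w' - grad f w) \<le> (L0 + L1 * ?N \<tau>) * norm (w' - w)"
    using sym_smooth_on_line[OF sym, of 0 1 w "w' - w"] by auto
  note \<tau>(2)
  also have "(L0 + L1 * ?N \<tau>) * norm (w' - w) \<le> (L0 + L1 * B) * norm (w' - w)"
    using \<tau>(1) L by (intro mult_right_mono add_left_mono mult_left_mono B)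
      (auto intro: mult_left_le_one_le)
  finally show ?thesis .
qed

text \<open>Here \<open>h x = L0 / L1 + x\<close> and \<open>F\<close> is the logarithm of \<open>h\<close>.\<close>

lemma sym_smooth_imp_exp_growth_bound:
  fixes f :: "'a::real_inner \<Rightarrow> real"
  assumes sym: "sym_smooth_with 1 L0 L1 f"
  shows "exp_growth_bound L0 L1 f"
  unfolding exp_growth_bound_def
proof (intro allI)
  fix w w' :: 'a
  have L: "L0 > 0" "L1 > 0" using sym by (auto simp: sym_smooth_with_def)
  define E where "E = (L0 + L1 * norm (grad f w)) * exp (L1 * norm (w' - w))"
  have growth: "L0 + L1 * norm (grad f u) \<le> E" if "norm (u - w) \<le> norm (w' - w)" for u
  proof -
    let ?h = "\<lambda>x. L0 / L1 + x"
    have pos: "?h x > 0" if "x \<ge> 0" for x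
      using that L by (simp add: add_pos_nonneg)
    have "ln (?h (norm (grad f u))) \<le> ln (?h (norm (grad f w))) + L1 * norm (u - w)"
    proof (rule sym_smooth_norm_grad_growth[OF sym, where h = ?h])
      fix x :: real assume "x \<ge> 0"
      then show "DERIV (\<lambda>x. ln (?h x)) x :> 1 / ?h x"
        using pos by (auto intro!: derivative_eq_intros)
      show "L0 + L1 * nnpow x 1 \<le> L1 * ?h x"
        using L \<open>x \<ge> 0\<close> by (simp add: nnpow_eq_powr distrib_left)
    qed (use pos L in \<open>auto intro!: continuous_intros\<close>)
    also have "\<dots> \<le> ln (?h (norm (grad f w))) + L1 * norm (w' - w)"
      using that L by simp
    finally have "exp (ln (?h (norm (grad f u))))
        \<le> exp (ln (?h (norm (grad f w))) + L1 * norm (w' - w))" by simp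
    then have "?h (norm (grad f u)) \<le> ?h (norm (grad f w)) * exp (L1 * norm (w' - w))"
      using pos by (simp add: exp_add)
    then have "L1 * ?h (norm (grad f u)) \<le> L1 * (?h (norm (grad f w)) * exp (L1 * norm (w' - w)))"
      using L by simp
    then show ?thesis
      unfolding E_def mult.assoc[symmetric] distrib_left using L by simp
  qed
  \<comment> \<open>The bound on the gradient norm is \<open>growth\<close> solved for that norm.\<close>
  have "norm (grad f w' - grad f w) \<le> (L0 + L1 * ((E - L0) / L1)) * norm (w' - w)"
    using growth L by (intro sym_smooth_increment_le[OF sym])
      (auto simp: nnpow_eq_powr field_simps)
  then show "norm (grad f w' - grad f w)
      \<le> norm (w' - w) * (L0 + L1 * norm (grad f w)) * exp (L1 * norm (w' - w))"
    using L by (simp add: E_def mult_ac)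
qed

text \<open>The shift \<open>a\<close> is chosen with \<open>L1 * a powr \<alpha> = L0\<close>, so that the constant \<open>L0\<close> becomes
  a power like the other term and one power of \<open>a + x\<close> dominates both. Splitting the sum
  under the power by subadditivity leaves the factors 1 and \<open>2 powr \<alpha>\<close>, both at most the
  \<open>3 powr \<alpha>\<close> of the constants.\<close>

lemma sym_smooth_imp_growth_bound:
  fixes f :: "'a::real_inner \<Rightarrow> real"
  assumes \<alpha>: "0 < \<alpha>" "\<alpha> < 1" and sym: "sym_smooth_with \<alpha> L0 L1 f"
  shows "growth_bound \<alpha> L0 L1 f"
  unfolding growth_bound_def
proof (intro allI)
  fix w w' :: 'a
  have L: "L0 > 0" "L1 > 0" using sym by (auto simp: sym_smooth_with_def)
  define a where "a = (L0 / L1) powr (1 / \<alpha>)"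
  have a: "a > 0" "a powr \<alpha> = L0 / L1"
    using L \<alpha> by (auto simp: a_def powr_powr)
  \<comment> \<open>The exponents \<open>1 / (1 - \<alpha>)\<close> and \<open>\<alpha>\<^sup>2 / (1 - \<alpha>)\<close> are \<open>1 + q\<close> and \<open>q * \<alpha>\<close>.\<close>
  define q where "q = \<alpha> / (1 - \<alpha>)"
  have q: "q > 0" "1 / (1 - \<alpha>) = 1 + q" "(1 + q) * \<alpha> = q" "(1 - \<alpha>) * (1 + q) = 1"
    using \<alpha> by (auto simp: q_def field_simps)
  have q2: "\<alpha>\<^sup>2 / (1 - \<alpha>) = q * \<alpha>"
    by (simp add: q_def power2_eq_square)
  define g where "g = norm (grad f w)"
  define X where "X = (1 - \<alpha>) * L1 * norm (w' - w)"
  have gX: "g \<ge> 0" "X \<ge> 0" using \<alpha> L by (auto simp: g_def X_def)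
  define B where "B = 2 powr (q * \<alpha>) * (a powr \<alpha> + g powr \<alpha> + 2 powr \<alpha> * X powr q)"
  have growth: "norm (grad f u) powr \<alpha> \<le> B" if u: "norm (u - w) \<le> norm (w' - w)" for u
  proof -
    let ?h = "\<lambda>x. (a + x) powr \<alpha>" and ?F = "\<lambda>x. (a + x) powr (1 - \<alpha>) / (1 - \<alpha>)"
    define y where "y = norm (grad f u)"
    have "?F y \<le> ?F g + (2 powr (1 - \<alpha>) * L1) * norm (u - w)"
      unfolding y_def g_def
    proof (rule sym_smooth_norm_grad_growth[OF sym, where h = ?h and F = ?F])
      show "continuous_on {0..} ?h"
        using a(1) by (intro continuous_intros) auto
      fix x :: real assume x: "x \<ge> 0"
      show "?h x > 0" using a(1) x by simp
      have "DERIV ?F x :> (1 - \<alpha>) * (a + x) powr (1 - \<alpha> - 1) / (1 - \<alpha>)"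
        using a(1) x by (auto intro!: derivative_eq_intros)
      then show "DERIV ?F x :> 1 / ?h x"
        using \<alpha> by (simp add: powr_minus_divide)
      have "L0 + L1 * nnpow x \<alpha> = L1 * (a powr \<alpha> + x powr \<alpha>)"
        using \<alpha> L a by (simp add: nnpow_eq_powr distrib_left)
      also have "\<dots> \<le> L1 * (2 powr (1 - \<alpha>) * (a + x) powr \<alpha>)"
        using L \<alpha> a x by (intro mult_left_mono powr_add_le_concave) auto
      finally show "L0 + L1 * nnpow x \<alpha> \<le> 2 powr (1 - \<alpha>) * L1 * ?h x"
        by (simp add: mult_ac)
    qed (use L in auto)
    also have "\<dots> \<le> ?F g + (2 powr (1 - \<alpha>) * L1) * norm (w' - w)"
      using u L by (intro add_left_mono mult_left_mono) auto
    finally have "(1 - \<alpha>) * ?F y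
        \<le> (1 - \<alpha>) * (?F g + (2 powr (1 - \<alpha>) * L1) * norm (w' - w))"
      using \<alpha> by (intro mult_left_mono) auto
    then have "(a + y) powr (1 - \<alpha>) \<le> (a + g) powr (1 - \<alpha>) + 2 powr (1 - \<alpha>) * X"
      unfolding distrib_left using \<alpha> by (simp add: X_def mult_ac)
    then have "((a + y) powr (1 - \<alpha>)) powr (1 + q)
        \<le> ((a + g) powr (1 - \<alpha>) + 2 powr (1 - \<alpha>) * X) powr (1 + q)"
      using q by (intro powr_mono2) auto
    also have "\<dots> \<le> 2 powr (1 + q - 1) * (((a + g) powr (1 - \<alpha>)) powr (1 + q)
                        + (2 powr (1 - \<alpha>) * X) powr (1 + q))"
      using gX q by (intro powr_add_le_convex) auto
    also have "\<dots> = 2 powr q * (a + g + 2 * X powr (1 + q))"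
      using gX q a by (simp add: powr_powr powr_mult)
    finally have "a + y \<le> 2 powr q * (a + g + 2 * X powr (1 + q))"
      using q a by (simp add: powr_powr y_def)
    then have "y powr \<alpha> \<le> (2 powr q * (a + g + 2 * X powr (1 + q))) powr \<alpha>"
      using a \<alpha> by (intro powr_mono2) (auto simp: y_def)
    also have "\<dots> = 2 powr (q * \<alpha>) * (a + g + 2 * X powr (1 + q)) powr \<alpha>"
      using a gX by (simp add: powr_mult powr_powr)
    also have "(a + g + 2 * X powr (1 + q)) powr \<alpha>
        \<le> (a + g) powr \<alpha> + (2 * X powr (1 + q)) powr \<alpha>"
      using a gX \<alpha> by (intro powr_add_le_powr) auto
    also have "\<dots> \<le> a powr \<alpha> + g powr \<alpha> + (2 * X powr (1 + q)) powr \<alpha>"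
      using a gX \<alpha> by (intro add_right_mono powr_add_le_powr) auto
    also have "(2 * X powr (1 + q)) powr \<alpha> = 2 powr \<alpha> * X powr q"
      using gX q by (simp add: powr_mult powr_powr)
    finally show ?thesis by (simp add: y_def B_def)
  qed
  have "norm (grad f w' - grad f w) \<le> (L0 + L1 * B) * norm (w' - w)"
    using \<alpha> growth by (intro sym_smooth_increment_le[OF sym]) (auto simp: nnpow_eq_powr)
  also have "L0 + L1 * B \<le> K0 \<alpha> L0 + K1 \<alpha> L1 * g powr \<alpha> + K2 \<alpha> L1 * norm (w' - w) powr q"
  proof -
    let ?c = "2 powr (q * \<alpha>) :: real"
    have "L1 * X powr q = L1 powr (1 + q) * (1 - \<alpha>) powr q * norm (w' - w) powr q"
      using L \<alpha> by (simp add: X_def powr_mult powr_add)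
    then have K2: "K2 \<alpha> L1 * norm (w' - w) powr q = L1 * (?c * (3 powr \<alpha> * X powr q))"
      by (simp add: K2_def q q2 mult_ac flip: q_def)
    have K1: "K1 \<alpha> L1 * g powr \<alpha> = L1 * (?c * (3 powr \<alpha> * g powr \<alpha>))"
      by (simp add: K1_def q2 mult_ac)
    have K0: "K0 \<alpha> L0 = L0 + L1 * (?c * a powr \<alpha>)"
      using L by (simp add: K0_def q2 a distrib_left mult_ac)
    have "1 * g powr \<alpha> \<le> 3 powr \<alpha> * g powr \<alpha>"
      using \<alpha> by (intro mult_right_mono ge_one_powr_ge_zero) auto
    moreover have "2 powr \<alpha> * X powr q \<le> 3 powr \<alpha> * X powr q"
      using \<alpha> by (intro mult_right_mono powr_mono2) auto
    ultimately have "B \<le> ?c * (a powr \<alpha> + 3 powr \<alpha> * g powr \<alpha> + 3 powr \<alpha> * X powr q)"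
      unfolding B_def by (intro mult_left_mono) auto
    then have "L0 + L1 * B
        \<le> L0 + L1 * (?c * (a powr \<alpha> + 3 powr \<alpha> * g powr \<alpha> + 3 powr \<alpha> * X powr q))"
      using L by (intro add_left_mono mult_left_mono) auto
    then show ?thesis unfolding K0 K1 K2 by (simp add: distrib_left)
  qed
  finally show "norm (grad f w' - grad f w) \<le> norm (w' - w) *
        (K0 \<alpha> L0 + K1 \<alpha> L1 * norm (grad f w) powr \<alpha>
          + K2 \<alpha> L1 * norm (w' - w) powr (\<alpha> / (1 - \<alpha>)))"
    by (simp add: mult.commute mult_right_mono g_def q_def)
qed

section \<open>From growth bounds to symmetric smoothness\<close>

text \<open>Near the diagonal \<open>\<rho>\<close> is below \<open>1 + r\<close>. With \<open>w\<close> fixed this makes the gradient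
  continuous at \<open>w\<close>; on a segment it bounds the slope of the distance from the initial gradient by
  \<open>1 + r\<close> times the constant belonging to the maximum, and \<open>r\<close> is arbitrary.\<close>

lemma sym_smooth_with_if_local_bound:
  fixes f :: "'a::real_inner \<Rightarrow> real"
  assumes "\<alpha> > 0" and AB: "A > 0" "B > 0"
    and \<rho>: "(\<rho> \<longlongrightarrow> 1) (at_right 0)"
    and bound: "\<And>w w'. w' \<noteq> w \<Longrightarrow> norm (grad f w' - grad f w)
      \<le> norm (w' - w) * (A + B * norm (grad f w) powr \<alpha>) * \<rho> (norm (w' - w))"
  shows "sym_smooth_with \<alpha> A B f"
proof -
  have local_bound: "\<exists>d>0. \<forall>w w'. norm (w' - w) < d \<longrightarrow> norm (grad f w' - grad f w)
      \<le> norm (w' - w) * (A + B * norm (grad f w) powr \<alpha>) * (1 + r)" if "r > 0" for r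
  proof -
    have "eventually (\<lambda>x. \<rho> x < 1 + r) (at_right 0)"
      using that by (intro order_tendstoD(2)[OF \<rho>]) auto
    then obtain d where d: "d > 0" "\<And>x. 0 < x \<Longrightarrow> x < d \<Longrightarrow> \<rho> x < 1 + r"
      by (auto simp: eventually_at_right_field)
    have "norm (grad f w' - grad f w)
        \<le> norm (w' - w) * (A + B * norm (grad f w) powr \<alpha>) * (1 + r)"
      if "norm (w' - w) < d" for w w'
    proof (cases "w' = w")
      case False
      have "norm (w' - w) * (A + B * norm (grad f w) powr \<alpha>) * \<rho> (norm (w' - w))
          \<le> norm (w' - w) * (A + B * norm (grad f w) powr \<alpha>) * (1 + r)"
        using d(2)[of "norm (w' - w)"] that False AB by (intro mult_left_mono) auto
      with bound[OF False] show ?thesis by (rule order_trans)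
    qed simp
    with d(1) show ?thesis by blast
  qed
  have cont: "continuous (at w) (grad f)" for w
  proof -
    define K where "K = (A + B * norm (grad f w) powr \<alpha>) * 2"
    obtain d where d: "d > 0" "\<And>w'. norm (w' - w) < d \<Longrightarrow>
        norm (grad f w' - grad f w) \<le> norm (w' - w) * K"
      unfolding K_def mult.assoc[symmetric]
      using local_bound[OF zero_less_one] unfolding one_add_one by blast
    have "((\<lambda>w'. grad f w' - grad f w) \<longlongrightarrow> 0) (at w)"
    proof (rule tendsto_0_le)
      show "((\<lambda>w'. w' - w) \<longlongrightarrow> 0) (at w)"
        by (auto intro!: tendsto_eq_intros)
      show "eventually (\<lambda>w'. norm (grad f w' - grad f w) \<le> norm (w' - w) * K) (at w)"
        unfolding eventually_at using d by (auto simp: dist_norm)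
    qed
    then show ?thesis
      unfolding continuous_within by (rule LIM_zero_cancel)
  qed
  show ?thesis
    unfolding sym_smooth_with_def
  proof (intro conjI allI AB)
    fix w w' :: 'a
    define p where "p = (\<lambda>t. t *\<^sub>R w' + (1 - t) *\<^sub>R w)"
    define N where "N = (\<lambda>t. nnpow (norm (grad f (p t))) \<alpha>)"
    have N: "N t = norm (grad f (p t)) powr \<alpha>" for t
      using \<open>\<alpha> > 0\<close> by (simp add: N_def nnpow_eq_powr)
    have "continuous_on UNIV (grad f)"
      using cont by (simp add: continuous_on_eq_continuous_at)
    then have "continuous_on {0..1} (\<lambda>t. grad f (p t))"
      by (rule continuous_on_compose2) (auto simp: p_def intro!: continuous_intros)
    then have "continuous_on {0..1} N"
      unfolding N using \<open>\<alpha> > 0\<close> by (intro continuous_on_powr' continuous_intros) auto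
    then obtain m where m: "m \<in> {0..1}" "\<And>t. t \<in> {0..1} \<Longrightarrow> N t \<le> N m"
      using continuous_attains_sup[of "{0..1::real}" N] by auto
    define C where "C = norm (w' - w) * (A + B * N m)"
    have "N m \<ge> 0" by (simp add: N)
    then have "C \<ge> 0" using AB by (simp add: C_def)
    have "norm (grad f (p 1) - grad f (p 0)) \<le> norm (grad f (p 0) - grad f (p 0)) + C"
    proof (rule increment_le_of_local_slope[where z = "\<lambda>t. norm (grad f (p t) - grad f (p 0))"])
      fix e :: real assume "e > 0"
      define r where "r = e / (C + 1)"
      have r: "r > 0" "C * r \<le> e"
        using \<open>e > 0\<close> \<open>C \<ge> 0\<close> by (auto simp: r_def field_simps)
      obtain d where d: "d > 0" and step: "\<And>w w'. norm (w' - w) < d \<Longrightarrow>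
          norm (grad f w' - grad f w)
            \<le> norm (w' - w) * (A + B * norm (grad f w) powr \<alpha>) * (1 + r)"
        using local_bound[OF r(1)] by blast
      have "norm (grad f (p s) - grad f (p 0)) - norm (grad f (p t) - grad f (p 0))
          \<le> (C + e) * (s - t)"
        if ts: "0 \<le> t" "t \<le> s" "s \<le> 1" "s < t + d / (norm (w' - w) + 1)" for t s
      proof -
        have "p s - p t = (s - t) *\<^sub>R (w' - w)" by (simp add: p_def algebra_simps)
        then have dist: "norm (p s - p t) = (s - t) * norm (w' - w)" using ts by simp
        also have "\<dots> \<le> (s - t) * (norm (w' - w) + 1)"
          using ts by (intro mult_left_mono) auto
        also have "\<dots> < d"
        proof -
          have "norm (w' - w) + 1 > 0" by (simp add: add_nonneg_pos)
          moreover have "s - t < d / (norm (w' - w) + 1)" using ts by linarith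
          ultimately show ?thesis by (simp add: pos_less_divide_eq)
        qed
        finally have near: "norm (p s - p t) < d" .
        have "norm (grad f (p s) - grad f (p 0)) - norm (grad f (p t) - grad f (p 0))
            \<le> norm (grad f (p s) - grad f (p t))"
          using norm_triangle_ineq2[of "grad f (p s) - grad f (p 0)" "grad f (p t) - grad f (p 0)"]
          by simp
        also have "\<dots> \<le> (s - t) * norm (w' - w) * (A + B * N t) * (1 + r)"
          using step[OF near] by (simp add: dist N)
        also have "\<dots> \<le> (s - t) * norm (w' - w) * (A + B * N m) * (1 + r)"
          using m(2)[of t] ts AB r
          by (intro mult_right_mono mult_left_mono add_left_mono) auto
        also have "\<dots> = (C + C * r) * (s - t)"
          by (simp add: C_def algebra_simps)
        also have "\<dots> \<le> (C + e) * (s - t)"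
          using r ts by (intro mult_right_mono) auto
        finally show ?thesis .
      qed
      moreover have "d / (norm (w' - w) + 1) > 0"
        using d by (simp add: add_nonneg_pos)
      ultimately show "\<exists>d>0. \<forall>t s. 0 \<le> t \<and> t \<le> s \<and> s \<le> 1 \<and> s < t + d \<longrightarrow>
          norm (grad f (p s) - grad f (p 0)) - norm (grad f (p t) - grad f (p 0))
            \<le> (C + e) * (s - t)" by blast
    qed
    then have "norm (grad f w' - grad f w) \<le> (A + B * N m) * norm (w' - w)"
      by (simp add: p_def C_def mult.commute)
    with m show "\<exists>M\<in>(\<lambda>\<theta>. nnpow (norm (grad f (\<theta> *\<^sub>R w' + (1 - \<theta>) *\<^sub>R w))) \<alpha>) ` {0..1}.
        (\<forall>\<theta>\<in>{0..1}. nnpow (norm (grad f (\<theta> *\<^sub>R w' + (1 - \<theta>) *\<^sub>R w))) \<alpha> \<le> M) \<and>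
        norm (grad f w' - grad f w) \<le> (A + B * M) * norm (w' - w)"
      unfolding N_def p_def by blast
  qed
qed

text \<open>The additive term with \<open>K2\<close> becomes part of the factor \<open>\<rho>\<close>: since
  \<open>K0 \<alpha> L0\<close> is positive, the term is at most a multiple of
  \<open>K0 \<alpha> L0 + K1 \<alpha> L1 * norm (grad f w) powr \<alpha>\<close> that vanishes with the distance.\<close>

lemma growth_bound_imp_sym_smooth:
  fixes f :: "'a::real_inner \<Rightarrow> real"
  assumes \<alpha>: "0 < \<alpha>" "\<alpha> < 1" and L: "L0 > 0" "L1 > 0" and growth: "growth_bound \<alpha> L0 L1 f"
  shows "sym_smooth_with \<alpha> (K0 \<alpha> L0) (K1 \<alpha> L1) f"
proof -
  define q where "q = \<alpha> / (1 - \<alpha>)"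
  have q: "q > 0" using \<alpha> by (simp add: q_def)
  have K: "K0 \<alpha> L0 > 0" "K1 \<alpha> L1 > 0" "K2 \<alpha> L1 \<ge> 0"
    using L by (auto simp: K0_def K1_def K2_def add_pos_pos)
  define \<rho> where "\<rho> = (\<lambda>x. 1 + K2 \<alpha> L1 / K0 \<alpha> L0 * x powr q)"
  show ?thesis
  proof (rule sym_smooth_with_if_local_bound)
    have "((\<lambda>x. x powr q) \<longlongrightarrow> 0 powr q) (at_right 0)"
      using q by (intro tendsto_powr') (auto simp: eventually_at_right_less
          intro: eventually_at_right_less[THEN eventually_mono])
    then have "(\<rho> \<longlongrightarrow> 1 + K2 \<alpha> L1 / K0 \<alpha> L0 * 0 powr q) (at_right 0)"
      unfolding \<rho>_def by (intro tendsto_add tendsto_mult tendsto_const)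
    then show "(\<rho> \<longlongrightarrow> 1) (at_right 0)" by simp
    fix w w' :: 'a
    let ?D = "norm (w' - w)" and ?S = "K0 \<alpha> L0 + K1 \<alpha> L1 * norm (grad f w) powr \<alpha>"
    have "K2 \<alpha> L1 * ?D powr q = K0 \<alpha> L0 * (K2 \<alpha> L1 / K0 \<alpha> L0 * ?D powr q)"
      using K by simp
    also have "\<dots> \<le> ?S * (K2 \<alpha> L1 / K0 \<alpha> L0 * ?D powr q)"
      using K by (intro mult_right_mono) auto
    finally have "?S + K2 \<alpha> L1 * ?D powr q \<le> ?S * \<rho> ?D"
      unfolding \<rho>_def by (simp only: distrib_left mult_1_right add_left_mono)
    then have "?D * (?S + K2 \<alpha> L1 * ?D powr q) \<le> ?D * ?S * \<rho> ?D"
      unfolding mult.assoc by (intro mult_left_mono) auto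
    moreover have "norm (grad f w' - grad f w) \<le> ?D * (?S + K2 \<alpha> L1 * ?D powr q)"
      using growth by (simp add: growth_bound_def q_def)
    ultimately show "norm (grad f w' - grad f w) \<le> ?D * ?S * \<rho> ?D" by linarith
  qed (use \<alpha> K in auto)
qed

lemma exp_growth_bound_imp_sym_smooth:
  fixes f :: "'a::real_inner \<Rightarrow> real"
  assumes L: "L0 > 0" "L1 > 0" and growth: "exp_growth_bound L0 L1 f"
  shows "sym_smooth_with 1 L0 L1 f"
proof (rule sym_smooth_with_if_local_bound[where \<rho> = "\<lambda>x. exp (L1 * x)"])
  show "((\<lambda>x. exp (L1 * x)) \<longlongrightarrow> 1) (at_right 0)"
    by (auto intro!: tendsto_eq_intros)
qed (use L growth in \<open>auto simp: exp_growth_bound_def\<close>)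

section \<open>The descent inequality\<close>

text \<open>Subtracting from \<open>f\<close>, along the segment, its linear part at \<open>w\<close> and the claimed quadratic
  leaves a function \<open>k\<close> whose derivative is nonpositive by the bound on the gradient.\<close>

lemma descent_inequality:
  fixes f :: "'a::euclidean_space \<Rightarrow> real"
  assumes diff: "\<And>x. f differentiable (at x)"
    and B: "\<And>u. norm (u - w) \<le> norm (w' - w) \<Longrightarrow>
               norm (grad f u - grad f w) \<le> norm (u - w) * B"
  shows "f w' \<le> f w + grad f w \<bullet> (w' - w) + 1 / 2 * (norm (w' - w))\<^sup>2 * B"
proof -
  define v where "v = w' - w"
  define k where "k = (\<lambda>t. f (w + t *\<^sub>R v) - t * (grad f w \<bullet> v) - t\<^sup>2 * (1 / 2 * (norm v)\<^sup>2 * B))"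
  have "k 1 \<le> k 0"
  proof (rule DERIV_nonpos_imp_nonincreasing[of 0 1 k])
    fix t :: real assume t: "0 \<le> t" "t \<le> 1"
    let ?u = "w + t *\<^sub>R v"
    have "(f has_derivative (\<lambda>h. h \<bullet> grad f ?u)) (at ?u)"
      using GDERIV_grad[OF diff] by (simp add: gderiv_def)
    moreover have "((\<lambda>t. w + t *\<^sub>R v) has_derivative (\<lambda>x. x *\<^sub>R v)) (at t)"
      by (auto intro!: derivative_eq_intros)
    ultimately have "((\<lambda>t. f (w + t *\<^sub>R v)) has_derivative (\<lambda>x. (x *\<^sub>R v) \<bullet> grad f ?u)) (at t)"
      using has_derivative_compose by blast
    then have "DERIV (\<lambda>t. f (w + t *\<^sub>R v)) t :> v \<bullet> grad f ?u"
      by (simp add: has_field_derivative_def mult_commute_abs)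
    then have "DERIV k t :> v \<bullet> grad f ?u - grad f w \<bullet> v - 2 * t * (1 / 2 * (norm v)\<^sup>2 * B)"
      unfolding k_def by (auto intro!: derivative_eq_intros)
    moreover have "v \<bullet> grad f ?u - grad f w \<bullet> v - 2 * t * (1 / 2 * (norm v)\<^sup>2 * B) \<le> 0"
    proof -
      have "v \<bullet> grad f ?u - grad f w \<bullet> v = v \<bullet> (grad f ?u - grad f w)"
        by (simp add: inner_diff_right inner_commute)
      also have "\<dots> \<le> norm v * norm (grad f ?u - grad f w)"
        by (rule norm_cauchy_schwarz)
      also have "\<dots> \<le> norm v * (norm (?u - w) * B)"
        using t by (intro mult_left_mono B) (auto simp: v_def mult_left_le_one_le)
      also have "\<dots> = 2 * t * (1 / 2 * (norm v)\<^sup>2 * B)"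
        using t by (simp add: power2_eq_square)
      finally show ?thesis by simp
    qed
    ultimately show "\<exists>y. DERIV k t :> y \<and> y \<le> 0" by blast
  qed simp
  then show ?thesis by (simp add: k_def v_def)
qed

text \<open>Between \<open>w\<close> and \<open>w'\<close> the factor depending on the distance is largest at \<open>w'\<close>.\<close>

lemma growth_bound_imp_descent:
  fixes f :: "'a::euclidean_space \<Rightarrow> real"
  assumes diff: "\<And>x. f differentiable (at x)"
    and \<alpha>: "0 < \<alpha>" "\<alpha> < 1" and growth: "growth_bound \<alpha> L0 L1 f"
  shows "f w' \<le> f w + grad f w \<bullet> (w' - w) + 1 / 2 * (norm (w' - w))\<^sup>2 *
           (K0 \<alpha> L0 + K1 \<alpha> L1 * norm (grad f w) powr \<alpha>
             + 2 * K2 \<alpha> L1 * norm (w' - w) powr (\<alpha> / (1 - \<alpha>)))"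
proof (rule descent_inequality[OF diff])
  fix u assume u: "norm (u - w) \<le> norm (w' - w)"
  let ?q = "\<alpha> / (1 - \<alpha>)" and ?S = "K0 \<alpha> L0 + K1 \<alpha> L1 * norm (grad f w) powr \<alpha>"
  have K2: "K2 \<alpha> L1 \<ge> 0" by (simp add: K2_def)
  have "norm (grad f u - grad f w) \<le> norm (u - w) * (?S + K2 \<alpha> L1 * norm (u - w) powr ?q)"
    using growth by (simp add: growth_bound_def)
  also have "K2 \<alpha> L1 * norm (u - w) powr ?q \<le> K2 \<alpha> L1 * norm (w' - w) powr ?q"
    using u \<alpha> K2 by (intro mult_left_mono powr_mono2) auto
  also have "\<dots> \<le> 2 * K2 \<alpha> L1 * norm (w' - w) powr ?q"
    using K2 by (intro mult_right_mono) auto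
  finally show "norm (grad f u - grad f w)
      \<le> norm (u - w) * (?S + 2 * K2 \<alpha> L1 * norm (w' - w) powr ?q)"
    by (simp add: mult_left_mono)
qed

lemma exp_growth_bound_imp_descent:
  fixes f :: "'a::euclidean_space \<Rightarrow> real"
  assumes diff: "\<And>x. f differentiable (at x)"
    and L: "L0 > 0" "L1 > 0" and growth: "exp_growth_bound L0 L1 f"
  shows "f w' \<le> f w + grad f w \<bullet> (w' - w) + 1 / 2 * (norm (w' - w))\<^sup>2 *
           (L0 + L1 * norm (grad f w)) * exp (L1 * norm (w' - w))"
proof -
  let ?S = "L0 + L1 * norm (grad f w)"
  have "f w' \<le> f w + grad f w \<bullet> (w' - w)
      + 1 / 2 * (norm (w' - w))\<^sup>2 * (?S * exp (L1 * norm (w' - w)))"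
  proof (rule descent_inequality[OF diff])
    fix u assume u: "norm (u - w) \<le> norm (w' - w)"
    have "norm (grad f u - grad f w) \<le> norm (u - w) * (?S * exp (L1 * norm (u - w)))"
      using growth by (simp add: exp_growth_bound_def mult.assoc)
    also have "\<dots> \<le> norm (u - w) * (?S * exp (L1 * norm (w' - w)))"
      using u L by (intro mult_left_mono) auto
    finally show "norm (grad f u - grad f w)
        \<le> norm (u - w) * (?S * exp (L1 * norm (w' - w)))" .
  qed
  then show ?thesis by (simp add: mult.assoc)
qed

section \<open>Characterization and descent\<close>

theorem proposition3p2:
  fixes f :: "real ^ 'n \<Rightarrow> real"
  assumes "\<forall>x. f differentiable (at x)"
  shows
    "(\<forall>\<alpha>. 0 < \<alpha> \<and> \<alpha> < 1 \<longrightarrow>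
        (f \<in> Lsym \<alpha> \<longleftrightarrow> (\<exists>L0 L1. L0 > 0 \<and> L1 > 0 \<and> growth_bound \<alpha> L0 L1 f)) \<and>
        (\<forall>L0 L1. sym_smooth_with \<alpha> L0 L1 f \<longrightarrow> growth_bound \<alpha> L0 L1 f)) \<and>
     (f \<in> Lsym 1 \<longleftrightarrow> (\<exists>L0 L1. L0 > 0 \<and> L1 > 0 \<and> exp_growth_bound L0 L1 f)) \<and>
     (\<forall>L0 L1. sym_smooth_with 1 L0 L1 f \<longrightarrow> exp_growth_bound L0 L1 f) \<and>
     (\<forall>\<alpha> L0 L1. 0 < \<alpha> \<and> \<alpha> < 1 \<and> sym_smooth_with \<alpha> L0 L1 f \<longrightarrow>
        (\<forall>w w'. f w' \<le> f w + grad f w \<bullet> (w' - w) + 1 / 2 * (norm (w' - w))\<^sup>2 *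
           (K0 \<alpha> L0 + K1 \<alpha> L1 * norm (grad f w) powr \<alpha>
             + 2 * K2 \<alpha> L1 * norm (w' - w) powr (\<alpha> / (1 - \<alpha>))))) \<and>
     (\<forall>L0 L1. sym_smooth_with 1 L0 L1 f \<longrightarrow>
        (\<forall>w w'. f w' \<le> f w + grad f w \<bullet> (w' - w) + 1 / 2 * (norm (w' - w))\<^sup>2 *
           (L0 + L1 * norm (grad f w)) * exp (L1 * norm (w' - w))))"
proof (intro conjI allI impI)
  note diff = assms[rule_format]
  have pos: "L0 > 0 \<and> L1 > 0" if "sym_smooth_with \<alpha> L0 L1 f" for \<alpha> L0 L1
    using that by (simp add: sym_smooth_with_def)
  show "f \<in> Lsym 1 \<longleftrightarrow> (\<exists>L0 L1. L0 > 0 \<and> L1 > 0 \<and> exp_growth_bound L0 L1 f)"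
    unfolding Lsym_def mem_Collect_eq
    using assms pos sym_smooth_imp_exp_growth_bound exp_growth_bound_imp_sym_smooth by blast
  {
    fix \<alpha> :: real assume "0 < \<alpha> \<and> \<alpha> < 1"
    then show "f \<in> Lsym \<alpha> \<longleftrightarrow> (\<exists>L0 L1. L0 > 0 \<and> L1 > 0 \<and> growth_bound \<alpha> L0 L1 f)"
      unfolding Lsym_def mem_Collect_eq
      using assms pos sym_smooth_imp_growth_bound growth_bound_imp_sym_smooth by blast
  }
  fix \<alpha> L0 L1 w w'
  {
    assume "0 < \<alpha> \<and> \<alpha> < 1" "sym_smooth_with \<alpha> L0 L1 f"
    then show "growth_bound \<alpha> L0 L1 f" by (simp add: sym_smooth_imp_growth_bound)
  }
  {
    assume "0 < \<alpha> \<and> \<alpha> < 1 \<and> sym_smooth_with \<alpha> L0 L1 f"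
    then show "f w' \<le> f w + grad f w \<bullet> (w' - w) + 1 / 2 * (norm (w' - w))\<^sup>2 *
           (K0 \<alpha> L0 + K1 \<alpha> L1 * norm (grad f w) powr \<alpha>
             + 2 * K2 \<alpha> L1 * norm (w' - w) powr (\<alpha> / (1 - \<alpha>)))"
      using pos by (intro growth_bound_imp_descent diff sym_smooth_imp_growth_bound) auto
  }
  assume sym: "sym_smooth_with 1 L0 L1 f"
  then show exp: "exp_growth_bound L0 L1 f"
    by (rule sym_smooth_imp_exp_growth_bound)
  show "f w' \<le> f w + grad f w \<bullet> (w' - w) + 1 / 2 * (norm (w' - w))\<^sup>2 *
           (L0 + L1 * norm (grad f w)) * exp (L1 * norm (w' - w))"
    using pos[OF sym] exp by (intro exp_growth_bound_imp_descent diff) auto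
qed

end
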